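(* Let $\Delta(ABC)$ be a Euclidean triangle with circumcircle $\mathbf{O}$, let the open disc bounded by $\mathbf{O}$ be regarded as the Klein–Beltrami model of the hyperbolic plane $\mathbb{H}$ with absolute $\mathbf{O}$, and let $S$ be the symmedian point of $\Delta(ABC)$. For a point $X$ in the interior of $\Delta(ABC)$, let $\Delta(A'B'C')$ be the Cevian triangle of $X$, and let $\mathrm{per}(X)=d_{\mathcal K}(A',B')+d_{\mathcal K}(B',C')+d_{\mathcal K}(C',A')$ be its hyperbolic perimeter. Then $S$ minimizes $\mathrm{per}$, i.e. $\mathrm{per}(S)\le \mathrm{per}(X)$ for every such $X$.
   Context: The symmedian point $S$ of $\Delta(ABC)$ is the common point of the lines $AA^*$, $BB^*$, $CC^*$, where $A^*$ is the intersection of the tangents to the circumcircle $\mathbf{O}$ at $B$ and $C$ (possibly a point at infinity), and $B^*$, $C^*$ are defined analogously. The Cevian triangle of $X$ is $\Delta(A'B'C')$, where $A'$ is the intersection of the line $AX$ with the line $BC$, and $B'$, $C'$ are defined similarly (on $CA$ and $AB$). After a similarity taking $\mathbf{O}$ to the unit circle in $\mathbb{R}^2$, the hyperbolic distance between points $X,Y$ of the open unit disc is $d_{\mathcal K}(X,Y)=\cosh^{-1}\dfrac{1-X\cdot Y}{\sqrt{(1-|X|^2)(1-|Y|^2)}}$; geodesics are the open chords. *)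

theory Defs
  imports "HOL-Analysis.Analysis"
begin

definition circumcenter :: "real^2 \<Rightarrow> real^2 \<Rightarrow> real^2 \<Rightarrow> real^2" where
  "circumcenter A B C = (THE c. dist c A = dist c B \<and> dist c B = dist c C)"

definition circumradius :: "real^2 \<Rightarrow> real^2 \<Rightarrow> real^2 \<Rightarrow> real" where
  "circumradius A B C = dist (circumcenter A B C) A"

definition tangent_line :: "real^2 \<Rightarrow> real^2 \<Rightarrow> (real^2) set" where
  "tangent_line c P = {Q. (Q - P) \<bullet> (P - c) = 0}"

text \<open>The line joining \<open>P\<close> to the intersection point of two distinct lines \<open>l\<close> and \<open>m\<close>.
  If \<open>l\<close> and \<open>m\<close> are parallel, their intersection is a point at infinity, and the
  joining line is the parallel to \<open>l\<close> through \<open>P\<close>.\<close>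

definition join_meet :: "real^2 \<Rightarrow> (real^2) set \<Rightarrow> (real^2) set \<Rightarrow> (real^2) set" where
  "join_meet P l m =
     (if l \<inter> m = {} then {P + (Q - R) | Q R. Q \<in> l \<and> R \<in> l}
      else affine hull {P, THE Q. Q \<in> l \<inter> m})"

definition symmedian_point :: "real^2 \<Rightarrow> real^2 \<Rightarrow> real^2 \<Rightarrow> real^2" where
  "symmedian_point A B C =
     (let t = tangent_line (circumcenter A B C)
      in THE S. S \<in> join_meet A (t B) (t C) \<and>
                S \<in> join_meet B (t C) (t A) \<and>
                S \<in> join_meet C (t A) (t B))"

definition cevian_foot :: "real^2 \<Rightarrow> real^2 \<Rightarrow> real^2 \<Rightarrow> real^2 \<Rightarrow> real^2" where
  "cevian_foot X A B C = (THE P. P \<in> affine hull {A, X} \<inter> affine hull {B, C})"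

definition klein_dist_unit :: "real^2 \<Rightarrow> real^2 \<Rightarrow> real" where
  "klein_dist_unit X Y =
     arcosh ((1 - X \<bullet> Y) / sqrt ((1 - (norm X)\<^sup>2) * (1 - (norm Y)\<^sup>2)))"

text \<open>The distance in the Klein--Beltrami model on the open disc with centre \<open>c\<close> and radius
  \<open>r\<close>, transported by the similarity \<open>X \<mapsto> (X - c) / r\<close>. Any other similarity onto the unit
  disc differs from this one by an orthogonal map, which leaves the distance unchanged.\<close>

definition klein_dist :: "real^2 \<Rightarrow> real \<Rightarrow> real^2 \<Rightarrow> real^2 \<Rightarrow> real" where
  "klein_dist c r X Y = klein_dist_unit ((X - c) /\<^sub>R r) ((Y - c) /\<^sub>R r)"

definition cevian_perimeter :: "real^2 \<Rightarrow> real^2 \<Rightarrow> real^2 \<Rightarrow> real^2 \<Rightarrow> real" where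
  "cevian_perimeter A B C X =
     (let d = klein_dist (circumcenter A B C) (circumradius A B C);
          A' = cevian_foot X A B C;
          B' = cevian_foot X B C A;
          C' = cevian_foot X C A B
      in d A' B' + d B' C' + d C' A')"

end

theory Submission
  imports Defs
begin

text \<open>
  In suitably rescaled barycentric coordinates the perimeter is a symmetric function, as every
  ideal triangle is congruent to an equilateral one inscribed in the circle. Let \<open>c\<close> and \<open>r\<close> be the centre and radius of the circumcircle.
  The cosh of the distance of two points \<open>P\<close> and \<open>Q\<close> of the disc is the form
  \<open>r\<^sup>2 - (P - c) \<bullet> (Q - c)\<close>, divided by the geometric mean of its values at the pairs \<open>(P, P)\<close>
  and \<open>(Q, Q)\<close>. This form is affine in each argument, vanishes at \<open>(A, A)\<close>, \<open>(B, B)\<close>, \<open>(C, C)\<close>, and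
  is half the squared side at two different vertices. Hence, if \<open>X\<close> has barycentric
  coordinates \<open>(x, y, z)\<close> and
    \<open>p = y z BC\<^sup>2\<close>, \<open>q = z x CA\<^sup>2\<close>, \<open>s = x y AB\<^sup>2\<close>,
  the first two feet of the Cevians are at distance \<open>arcosh ((p + q + s) / (2 \<surd>(p q)))\<close>, and
  cyclically for the other pairs (lemma \<open>cevian_perimeter_bary\<close>).

  It remains to minimise a function of three positive numbers. By the inequality of the means,
  the first distance is at least \<open>arcosh (1 + t / 2)\<close> with \<open>t = s / \<surd>(p q)\<close>. As a function of
  \<open>ln t\<close> this is convex, so it lies above its tangent at \<open>ln t = 0\<close>; the three numbers \<open>t\<close> have
  product \<open>1\<close>, the linear terms cancel, and the perimeter is at least \<open>3 arcosh (3/2)\<close>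
  (lemma \<open>arcosh_sum_ge\<close>). The bound is attained when \<open>p = q = s\<close>, that is, when \<open>x : y : z\<close> is
  \<open>BC\<^sup>2 : CA\<^sup>2 : AB\<^sup>2\<close>. These are the coordinates of the symmedian point
  (lemma \<open>symmedian_point_bary\<close>): the same form describes the tangents to the circumcircle at
  the vertices, and the line from \<open>A\<close> to the meet of the tangents at \<open>B\<close> and \<open>C\<close> has the equation
  \<open>y : z = CA\<^sup>2 : AB\<^sup>2\<close> even if the tangents are parallel.
\<close>

section \<open>A sharp inequality for the inverse hyperbolic cosine\<close>

text \<open>The derivative of the left side minus the right side has the sign of \<open>1 - z\<close>, because
  \<open>4 z + z\<^sup>2 \<le> 5 z\<^sup>2\<close> exactly if \<open>z \<ge> 1\<close>; the factor \<open>1 / sqrt 5\<close> is the slope of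
  \<open>arcosh (1 + z/2)\<close> as a function of \<open>ln z\<close> at \<open>z = 1\<close>, where both sides agree.\<close>
lemma arcosh_above_log_tangent:
  fixes z :: real
  assumes "z > 0"
  shows "arcosh (3/2) + ln z / sqrt 5 \<le> arcosh (1 + z/2)"
proof -
  define g where "g = (\<lambda>t::real. arcosh (1 + t/2) - ln t / sqrt 5)"
  have deriv: "(g has_real_derivative 1 / sqrt (4*t + t\<^sup>2) - 1 / sqrt (5 * t\<^sup>2)) (at t)"
    if "t > 0" for t
  proof -
    have "sqrt ((1 + t/2)\<^sup>2 - 1) = sqrt ((4*t + t\<^sup>2) / 4)"
      by (simp add: power2_eq_square field_simps)
    then have root: "sqrt ((1 + t/2)\<^sup>2 - 1) = sqrt (4*t + t\<^sup>2) / 2"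
      by (simp add: real_sqrt_divide)
    have "((\<lambda>t. arcosh (1 + t/2)) has_real_derivative
            (1 / sqrt ((1 + t/2)\<^sup>2 - 1)) * (1/2)) (at t)"
      by (rule DERIV_chain2[where f = arcosh], rule arcosh_real_has_field_derivative)
        (use that in \<open>auto intro!: derivative_eq_intros\<close>)
    moreover have "((\<lambda>t. ln t / sqrt 5) has_real_derivative (1/t) / sqrt 5) (at t)"
      using that by (auto intro!: derivative_eq_intros simp: field_simps)
    ultimately have "(g has_real_derivative
        (1 / sqrt ((1 + t/2)\<^sup>2 - 1)) * (1/2) - (1/t) / sqrt 5) (at t)"
      unfolding g_def by (rule DERIV_diff)
    moreover have "(1 / sqrt ((1 + t/2)\<^sup>2 - 1)) * (1/2) - (1/t) / sqrt 5
        = 1 / sqrt (4*t + t\<^sup>2) - 1 / sqrt (5 * t\<^sup>2)"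
      unfolding root using that by (simp add: real_sqrt_mult)
    ultimately show ?thesis by simp
  qed
  have "g 1 \<le> g z"
  proof (cases "z \<ge> 1")
    case True
    show ?thesis
    proof (rule DERIV_nonneg_imp_nondecreasing[OF True])
      fix t :: real assume t: "1 \<le> t" "t \<le> z"
      then have "4*t + t\<^sup>2 \<le> 5 * t\<^sup>2" by (simp add: power2_eq_square)
      then have "1 / sqrt (4*t + t\<^sup>2) - 1 / sqrt (5 * t\<^sup>2) \<ge> 0"
        using t by (auto intro!: divide_left_mono mult_pos_pos add_pos_pos)
      then show "\<exists>y. DERIV g t :> y \<and> y \<ge> 0" using deriv[of t] t by auto
    qed
  next
    case False
    then have "z \<le> 1" by simp
    then show ?thesis
    proof (rule DERIV_nonpos_imp_nonincreasing)
      fix t :: real assume t: "z \<le> t" "t \<le> 1"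
      then have pos: "t > 0" using assms by simp
      then have "4*t + t\<^sup>2 \<ge> 5 * t\<^sup>2" using t by (simp add: power2_eq_square)
      then have "1 / sqrt (4*t + t\<^sup>2) - 1 / sqrt (5 * t\<^sup>2) \<le> 0"
        using pos by (auto intro!: divide_left_mono mult_pos_pos add_pos_pos)
      then show "\<exists>y. DERIV g t :> y \<and> y \<le> 0" using deriv[of t] pos by auto
    qed
  qed
  then show ?thesis by (simp add: g_def)
qed

text \<open>Replacing \<open>p + q\<close> by \<open>2 sqrt (p q)\<close> leaves a function of \<open>s / sqrt (p q)\<close> alone. The
  logarithm of this quotient is written out so that the bounds for the three cyclic
  permutations can be added.\<close>
lemma arcosh_side_ge:
  fixes p q s :: real
  assumes "p > 0" "q > 0" "s > 0"
  shows "arcosh (3/2) + (ln s - (ln p + ln q) / 2) / sqrt 5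
           \<le> arcosh ((p + q + s) / (2 * sqrt (p * q)))"
proof -
  define z where "z = s / sqrt (p * q)"
  have z: "z > 0" using assms by (simp add: z_def)
  have lnz: "ln z = ln s - (ln p + ln q) / 2"
    using assms by (simp add: z_def ln_div ln_sqrt ln_mult)
  have "2 * sqrt (p * q) \<le> p + q"
    using arith_geo_mean_sqrt[of p q] assms by simp
  then have "(2 * sqrt (p * q) + s) / (2 * sqrt (p * q)) \<le> (p + q + s) / (2 * sqrt (p * q))"
    using assms by (intro divide_right_mono) auto
  moreover have "(2 * sqrt (p * q) + s) / (2 * sqrt (p * q)) = 1 + z/2"
    using assms by (simp add: z_def add_divide_distrib)
  ultimately have "1 + z/2 \<le> (p + q + s) / (2 * sqrt (p * q))" by simp
  then have "arcosh (1 + z/2) \<le> arcosh ((p + q + s) / (2 * sqrt (p * q)))"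
    using arcosh_less_iff_real[of "(p + q + s) / (2 * sqrt (p * q))" "1 + z/2"] z
    by (simp add: not_less flip: not_le)
  with arcosh_above_log_tangent[OF z] lnz show ?thesis by simp
qed

lemma arcosh_sum_ge:
  fixes p q s :: real
  assumes "p > 0" "q > 0" "s > 0"
  shows "3 * arcosh (3/2) \<le> arcosh ((p + q + s) / (2 * sqrt (p * q)))
     + arcosh ((p + q + s) / (2 * sqrt (q * s))) + arcosh ((p + q + s) / (2 * sqrt (s * p)))"
proof -
  \<comment> \<open>The product of \<open>s / sqrt (p q)\<close> and its cyclic permutations is \<open>1\<close>.\<close>
  have "(ln s - (ln p + ln q) / 2) / sqrt 5 + (ln p - (ln q + ln s) / 2) / sqrt 5
      + (ln q - (ln s + ln p) / 2) / sqrt 5 = 0"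
    by (simp add: field_simps)
  then show ?thesis
    using arcosh_side_ge[of p q s] arcosh_side_ge[of q s p] arcosh_side_ge[of s p q] assms
    by (simp add: add_ac)
qed

section \<open>Barycentric coordinates and the circumcircle\<close>

definition bary :: "real^2 \<Rightarrow> real^2 \<Rightarrow> real^2 \<Rightarrow> real \<Rightarrow> real \<Rightarrow> real \<Rightarrow> real^2" where
  "bary A B C x y z = x *\<^sub>R A + y *\<^sub>R B + z *\<^sub>R C"

lemma bary_cycle: "bary B C A y z x = bary A B C x y z"
  by (simp add: bary_def)

lemma not_collinear_cycle: "\<not> collinear {A, B, C} \<Longrightarrow> \<not> collinear {B, C, A}"
  by (simp add: insert_commute)

lemma not_collinear_imp_det_nonzero:
  fixes A B C :: "real^2"
  assumes "\<not> collinear {A, B, C}"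
  shows "(B$1 - A$1) * (C$2 - A$2) - (B$2 - A$2) * (C$1 - A$1) \<noteq> 0"
proof
  assume d: "(B$1 - A$1) * (C$2 - A$2) - (B$2 - A$2) * (C$1 - A$1) = 0"
  have parallel: "\<exists>k. v = k *\<^sub>R u" if "u \<noteq> 0" "u$1 * v$2 = u$2 * v$1" for u v :: "real^2"
  proof (cases "u$1 = 0")
    case True
    then have "v = (v$2 / u$2) *\<^sub>R u"
      using that by (auto simp: vec_eq_iff forall_2)
    then show ?thesis by blast
  next
    case False
    then have "v = (v$1 / u$1) *\<^sub>R u"
      using that by (simp add: vec_eq_iff forall_2 field_simps)
    then show ?thesis by blast
  qed
  have "collinear {0, B - A, C - A}"
    using parallel[of "B - A" "C - A"] d by (auto simp: collinear_lemma)
  then have "collinear {B, A, C}" by (simp add: collinear_3[of B A C])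
  then show False using assms by (simp add: insert_commute)
qed

lemma two_linear_equations_iff:
  fixes p q s t :: real
  assumes "p * t - q * s \<noteq> 0"
  shows "p * u + q * v = f \<and> s * u + t * v = g \<longleftrightarrow>
    u = (f * t - g * q) / (p * t - q * s) \<and> v = (g * p - f * s) / (p * t - q * s)"
proof -
  define d where "d = p * t - q * s"
  have d: "d \<noteq> 0" using assms by (simp add: d_def)
  have "p * u + q * v = f \<and> s * u + t * v = g \<longleftrightarrow>
    u * d = f * t - g * q \<and> v * d = g * p - f * s"
  proof
    assume "p * u + q * v = f \<and> s * u + t * v = g"
    then have f: "f = p * u + q * v" and g: "g = s * u + t * v" by simp_all
    show "u * d = f * t - g * q \<and> v * d = g * p - f * s"
      unfolding f g d_def by (simp add: algebra_simps)
  next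
    assume *: "u * d = f * t - g * q \<and> v * d = g * p - f * s"
    then have "d * (p * u + q * v) = d * f" "d * (s * u + t * v) = d * g"
      unfolding d_def by algebra+
    then show "p * u + q * v = f \<and> s * u + t * v = g" using d by simp
  qed
  then show ?thesis using d by (simp add: nonzero_eq_divide_eq flip: d_def)
qed

lemma bary_exists:
  fixes A B C P :: "real^2"
  assumes "\<not> collinear {A, B, C}"
  obtains x y z where "x + y + z = 1" "P = bary A B C x y z"
proof -
  have det: "(B$1 - A$1) * (C$2 - A$2) - (C$1 - A$1) * (B$2 - A$2) \<noteq> 0"
    using not_collinear_imp_det_nonzero[OF assms] by (simp add: mult.commute)
  obtain y z where "(B$1 - A$1) * y + (C$1 - A$1) * z = P$1 - A$1 \<and>
      (B$2 - A$2) * y + (C$2 - A$2) * z = P$2 - A$2"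
    unfolding two_linear_equations_iff[OF det] by blast
  then have "P = bary A B C (1 - y - z) y z"
    by (simp add: bary_def vec_eq_iff forall_2 algebra_simps)
  then show ?thesis using that[of "1 - y - z" y z] by simp
qed

lemma bary_eq_iff:
  fixes A B C :: "real^2"
  assumes "\<not> collinear {A, B, C}" "x + y + z = x' + y' + z'"
  shows "bary A B C x y z = bary A B C x' y' z' \<longleftrightarrow> x = x' \<and> y = y' \<and> z = z'"
proof
  assume eq: "bary A B C x y z = bary A B C x' y' z'"
  define d where "d = (B$1 - A$1) * (C$2 - A$2) - (B$2 - A$2) * (C$1 - A$1)"
  have d: "d \<noteq> 0" using not_collinear_imp_det_nonzero[OF assms(1)] by (simp add: d_def)
  have x: "x = x' + y' + z' - y - z" using assms(2) by simp
  have e1: "x * A$1 + y * B$1 + z * C$1 = x' * A$1 + y' * B$1 + z' * C$1"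
    and e2: "x * A$2 + y * B$2 + z * C$2 = x' * A$2 + y' * B$2 + z' * C$2"
    using arg_cong[OF eq, of "\<lambda>v. v$1"] arg_cong[OF eq, of "\<lambda>v. v$2"]
    by (simp_all add: bary_def)
  have "(y - y') * d = 0" "(z - z') * d = 0"
    using e1 e2 unfolding x d_def by algebra+
  then show "x = x' \<and> y = y' \<and> z = z'" using d x by simp
qed simp

text \<open>The circumcentre is a definite description, so its defining property needs existence and
  uniqueness: the perpendicular bisectors of \<open>AB\<close> and \<open>AC\<close> are two linear equations whose
  determinant is nonzero.\<close>
lemma circumcenter_equidistant:
  fixes A B C :: "real^2"
  assumes "\<not> collinear {A, B, C}"
  shows "dist (circumcenter A B C) A = dist (circumcenter A B C) B"
    and "dist (circumcenter A B C) B = dist (circumcenter A B C) C"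
proof -
  have det: "(B$1 - A$1) * (C$2 - A$2) - (B$2 - A$2) * (C$1 - A$1) \<noteq> 0"
    by (rule not_collinear_imp_det_nonzero[OF assms])
  have bisector: "dist c A = dist c P \<longleftrightarrow> (P$1 - A$1) * c$1 + (P$2 - A$2) * c$2
      = ((P$1)\<^sup>2 + (P$2)\<^sup>2 - (A$1)\<^sup>2 - (A$2)\<^sup>2) / 2" for c P :: "real^2"
  proof -
    have "dist c A = dist c P \<longleftrightarrow>
        (c$1 - A$1)\<^sup>2 + (c$2 - A$2)\<^sup>2 = (c$1 - P$1)\<^sup>2 + (c$2 - P$2)\<^sup>2"
      by (simp add: dist_vec_def L2_set_def sum_2 dist_real_def)
    also have "\<dots> \<longleftrightarrow> (P$1 - A$1) * c$1 + (P$2 - A$2) * c$2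
      = ((P$1)\<^sup>2 + (P$2)\<^sup>2 - (A$1)\<^sup>2 - (A$2)\<^sup>2) / 2"
      by (simp add: power2_diff algebra_simps eq_divide_eq)
    finally show ?thesis .
  qed
  have "\<exists>u v. \<forall>c. dist c A = dist c B \<and> dist c A = dist c C \<longleftrightarrow> c$1 = u \<and> c$2 = v"
    unfolding bisector two_linear_equations_iff[OF det] by (intro exI allI) (rule refl)
  then obtain u v where uv:
      "\<And>c. dist c A = dist c B \<and> dist c A = dist c C \<longleftrightarrow> c$1 = u \<and> c$2 = v"
    by blast
  have "\<exists>!c. dist c A = dist c B \<and> dist c A = dist c C"
    unfolding uv by (rule ex1I[of _ "vector [u, v]"]) (auto simp: vec_eq_iff forall_2)
  then have "\<exists>!c. dist c A = dist c B \<and> dist c B = dist c C" by metis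
  from theI'[OF this]
  show "dist (circumcenter A B C) A = dist (circumcenter A B C) B"
    and "dist (circumcenter A B C) B = dist (circumcenter A B C) C"
    by (simp_all add: circumcenter_def)
qed

text \<open>The symmetric form polar to the equation \<open>|P - c|\<^sup>2 = r\<^sup>2\<close> of the circle. It is the Lorentz
  product (with positive time direction) of the lifts \<open>(P - c, r)\<close> and \<open>(Q - c, r)\<close> to the
  hyperboloid picture: it determines the Klein--Beltrami distance, and the polar of a point
  on the circle is the tangent there.\<close>
definition polar_form :: "real^2 \<Rightarrow> real \<Rightarrow> real^2 \<Rightarrow> real^2 \<Rightarrow> real" where
  "polar_form c r P Q = r\<^sup>2 - (P - c) \<bullet> (Q - c)"

lemma polar_form_on_circle:
  assumes "dist c P = r" "dist c Q = r"
  shows "polar_form c r P Q = (dist P Q)\<^sup>2 / 2"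
proof -
  have "(P - c) \<bullet> (P - c) = r\<^sup>2" "(Q - c) \<bullet> (Q - c) = r\<^sup>2"
    using assms by (auto simp: dist_norm norm_minus_commute simp flip: power2_norm_eq_inner)
  moreover have "(dist P Q)\<^sup>2 = (P - c) \<bullet> (P - c) + (Q - c) \<bullet> (Q - c) - 2 * ((P - c) \<bullet> (Q - c))"
    by (simp add: dist_norm power2_norm_eq_inner algebra_simps inner_commute)
  ultimately show ?thesis by (simp add: polar_form_def)
qed

lemma polar_form_commute: "polar_form c r P Q = polar_form c r Q P"
  by (simp add: polar_form_def inner_commute)

lemma polar_form_bary_left:
  assumes "x + y + z = 1"
  shows "polar_form c r (bary A B C x y z) Q
    = x * polar_form c r A Q + y * polar_form c r B Q + z * polar_form c r C Q"
proof -
  have "x *\<^sub>R c + y *\<^sub>R c + z *\<^sub>R c = c" using assms by (simp flip: scaleR_add_left)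
  then have "bary A B C x y z - c = x *\<^sub>R (A - c) + y *\<^sub>R (B - c) + z *\<^sub>R (C - c)"
    by (simp add: bary_def algebra_simps)
  moreover have "r\<^sup>2 = x * r\<^sup>2 + y * r\<^sup>2 + z * r\<^sup>2" using assms by (simp flip: distrib_right)
  ultimately show ?thesis
    by (simp add: polar_form_def inner_add_left right_diff_distrib)
qed

text \<open>The squares of the coordinates do not occur, since the lifts of the vertices are null
  vectors: the form vanishes at \<open>(A, A)\<close>, \<open>(B, B)\<close> and \<open>(C, C)\<close>.\<close>
lemma polar_form_bary:
  assumes "dist c A = r" "dist c B = r" "dist c C = r"
    and "x + y + z = 1" "x' + y' + z' = 1"
  shows "polar_form c r (bary A B C x y z) (bary A B C x' y' z') =
    ((x * y' + y * x') * (dist A B)\<^sup>2 + (y * z' + z * y') * (dist B C)\<^sup>2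
      + (z * x' + x * z') * (dist C A)\<^sup>2) / 2"
proof -
  note right = polar_form_commute[of c r _ "bary A B C x' y' z'"]
  show ?thesis
    unfolding polar_form_bary_left[OF assms(4)] right polar_form_bary_left[OF assms(5)]
    using assms(1-3)
    by (simp add: polar_form_on_circle dist_commute algebra_simps)
qed

section \<open>The hyperbolic perimeter of a Cevian triangle\<close>

lemma klein_dist_eq_polar_form:
  assumes "r > 0"
  shows "klein_dist c r P Q =
    arcosh (polar_form c r P Q / sqrt (polar_form c r P P * polar_form c r Q Q))"
proof -
  have form: "1 - ((P - c) /\<^sub>R r) \<bullet> ((Q - c) /\<^sub>R r) = polar_form c r P Q / r\<^sup>2" for P Q
  proof -
    have "((P - c) /\<^sub>R r) \<bullet> ((Q - c) /\<^sub>R r) = ((P - c) \<bullet> (Q - c)) / r\<^sup>2"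
      unfolding inner_scaleR_left inner_scaleR_right
      by (simp add: power2_eq_square divide_inverse mult_ac)
    then show ?thesis using assms by (simp add: polar_form_def diff_divide_distrib)
  qed
  have "klein_dist c r P Q = arcosh (polar_form c r P Q / r\<^sup>2 /
      sqrt (polar_form c r P P / r\<^sup>2 * (polar_form c r Q Q / r\<^sup>2)))"
    unfolding klein_dist_def klein_dist_unit_def power2_norm_eq_inner form ..
  also have "sqrt (polar_form c r P P / r\<^sup>2 * (polar_form c r Q Q / r\<^sup>2))
      = sqrt (polar_form c r P P * polar_form c r Q Q) / r\<^sup>2"
    by (simp only: times_divide_times_eq real_sqrt_divide real_sqrt_abs2 abs_power2)
  finally show ?thesis using assms by simp
qed

lemma cevian_foot_bary:
  assumes "\<not> collinear {A, B, C}" "x > 0" "y > 0" "z > 0" "x + y + z = 1"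
  shows "cevian_foot (bary A B C x y z) A B C = bary A B C 0 (y / (y + z)) (z / (y + z))"
  unfolding cevian_foot_def
proof (rule the_equality)
  let ?X = "bary A B C x y z"
  define v where "v = 1 / (y + z)"
  have v: "v * (y + z) = 1" "y / (y + z) = v * y" "z / (y + z) = v * z"
    using assms by (simp_all add: v_def)
  have "(1 - v) *\<^sub>R A + v *\<^sub>R ?X = bary A B C (1 - v + v * x) (v * y) (v * z)"
    by (simp add: bary_def algebra_simps)
  moreover have "1 - v + v * x = 0" using v(1) assms(5) by algebra
  ultimately have "bary A B C 0 (v * y) (v * z) = (1 - v) *\<^sub>R A + v *\<^sub>R ?X" by simp
  moreover have "bary A B C 0 (v * y) (v * z) = (v * y) *\<^sub>R B + (v * z) *\<^sub>R C"
    by (simp add: bary_def)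
  moreover have "v * y + v * z = 1" "1 - v + v = 1" using v(1) by (simp_all add: algebra_simps)
  ultimately show "bary A B C 0 (y / (y + z)) (z / (y + z))
      \<in> affine hull {A, ?X} \<inter> affine hull {B, C}"
    unfolding affine_hull_2 v(2,3) by blast
  fix P assume "P \<in> affine hull {A, ?X} \<inter> affine hull {B, C}"
  then obtain u w s t where uw: "u + w = 1" "P = u *\<^sub>R A + w *\<^sub>R ?X"
    and st: "s + t = 1" "P = s *\<^sub>R B + t *\<^sub>R C"
    unfolding affine_hull_2 by blast
  have "P = bary A B C (u + w * x) (w * y) (w * z)"
    unfolding uw(2) by (simp add: bary_def algebra_simps)
  moreover have P: "P = bary A B C 0 s t" by (simp add: st(2) bary_def)
  moreover have "u + w * x + w * y + w * z = 0 + s + t"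
    using uw(1) st(1) assms(5) by (metis add.assoc add_0 distrib_left mult.right_neutral)
  ultimately have st': "s = w * y" "t = w * z"
    using bary_eq_iff[OF assms(1)] by metis+
  then have "w * (y + z) = 1" using st(1) by (simp add: algebra_simps)
  then have "w = v" using assms by (simp add: v_def field_simps)
  then show "P = bary A B C 0 (y / (y + z)) (z / (y + z))"
    using P st' v by simp
qed

text \<open>With \<open>m = y + z\<close> and \<open>n = z + x\<close>, the form at the two feet is \<open>(p + q + s) / (2 m n)\<close>, and
  it is \<open>p / m\<^sup>2\<close> and \<open>q / n\<^sup>2\<close> at each foot paired with itself; the denominators cancel.\<close>
lemma klein_dist_cevian_feet:
  fixes A B C :: "real^2"
  assumes circ: "dist c A = r" "dist c B = r" "dist c C = r" and "r > 0"
    and pos: "x > 0" "y > 0" "z > 0"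
    and p: "p = y * z * (dist B C)\<^sup>2" and q: "q = z * x * (dist C A)\<^sup>2"
    and s: "s = x * y * (dist A B)\<^sup>2"
  shows "klein_dist c r (bary A B C 0 (y / (y + z)) (z / (y + z)))
      (bary A B C (x / (z + x)) 0 (z / (z + x))) = arcosh ((p + q + s) / (2 * sqrt (p * q)))"
    (is "klein_dist c r ?P ?Q = _")
proof -
  define m n where "m = y + z" and "n = z + x"
  have mn: "m > 0" "n > 0" using pos by (auto simp: m_def n_def)
  have sums: "0 + y / m + z / m = 1" "x / n + 0 + z / n = 1"
    using mn by (simp_all add: m_def n_def flip: add_divide_distrib)
  note form = polar_form_bary[OF circ, folded m_def n_def]
  have PQ: "polar_form c r ?P ?Q = (p + q + s) / (2 * (m * n))"
    unfolding m_def[symmetric] n_def[symmetric] form[OF sums] p q s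
    using mn by (simp add: field_simps)
  have PP: "polar_form c r ?P ?P = p / m\<^sup>2"
    unfolding m_def[symmetric] n_def[symmetric] form[OF sums(1) sums(1)] p
    using mn by (simp add: field_simps power2_eq_square)
  have QQ: "polar_form c r ?Q ?Q = q / n\<^sup>2"
    unfolding m_def[symmetric] n_def[symmetric] form[OF sums(2) sums(2)] q
    using mn by (simp add: field_simps power2_eq_square)
  have "sqrt (p / m\<^sup>2 * (q / n\<^sup>2)) = sqrt (p * q) / (m * n)"
    using mn by (simp add: real_sqrt_divide real_sqrt_mult)
  then show ?thesis
    unfolding klein_dist_eq_polar_form[OF \<open>r > 0\<close>] PQ PP QQ using mn by simp
qed

lemma cevian_perimeter_bary:
  fixes A B C :: "real^2"
  assumes nc: "\<not> collinear {A, B, C}" and pos: "x > 0" "y > 0" "z > 0" "x + y + z = 1"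
    and p: "p = y * z * (dist B C)\<^sup>2" and q: "q = z * x * (dist C A)\<^sup>2"
    and s: "s = x * y * (dist A B)\<^sup>2"
  shows "cevian_perimeter A B C (bary A B C x y z) =
    arcosh ((p + q + s) / (2 * sqrt (p * q))) + arcosh ((p + q + s) / (2 * sqrt (q * s)))
      + arcosh ((p + q + s) / (2 * sqrt (s * p)))"
proof -
  define c r where "c = circumcenter A B C" and "r = circumradius A B C"
  have circ: "dist c A = r" "dist c B = r" "dist c C = r"
    using circumcenter_equidistant[OF nc] by (simp_all add: c_def r_def circumradius_def)
  have "r > 0"
  proof (rule ccontr)
    assume "\<not> r > 0"
    then have "r = 0" using circ(1) zero_le_dist[of c A] by simp
    with circ have "A = C" "B = C" by auto
    then show False using nc by simp
  qed
  have feet: "cevian_foot (bary A B C x y z) A B C = bary A B C 0 (y / (y + z)) (z / (y + z))"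
      "cevian_foot (bary A B C x y z) B C A = bary A B C (x / (z + x)) 0 (z / (z + x))"
      "cevian_foot (bary A B C x y z) C A B = bary A B C (x / (x + y)) (y / (x + y)) 0"
    using cevian_foot_bary[OF nc pos]
      cevian_foot_bary[OF not_collinear_cycle[OF nc], of y z x]
      cevian_foot_bary[OF not_collinear_cycle[OF not_collinear_cycle[OF nc]], of z x y] pos
    by (simp_all add: bary_def add_ac)
  have "klein_dist c r (bary A B C 0 (y / (y + z)) (z / (y + z)))
      (bary A B C (x / (z + x)) 0 (z / (z + x))) = arcosh ((p + q + s) / (2 * sqrt (p * q)))"
    using klein_dist_cevian_feet[OF circ \<open>r > 0\<close> pos(1-3) p q s] .
  moreover have "klein_dist c r (bary A B C (x / (z + x)) 0 (z / (z + x)))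
      (bary A B C (x / (x + y)) (y / (x + y)) 0) = arcosh ((p + q + s) / (2 * sqrt (q * s)))"
    using klein_dist_cevian_feet[OF circ(2,3,1) \<open>r > 0\<close> pos(2,3,1) q s p]
    by (simp add: bary_def add_ac)
  moreover have "klein_dist c r (bary A B C (x / (x + y)) (y / (x + y)) 0)
      (bary A B C 0 (y / (y + z)) (z / (y + z))) = arcosh ((p + q + s) / (2 * sqrt (s * p)))"
    using klein_dist_cevian_feet[OF circ(3,1,2) \<open>r > 0\<close> pos(3,1,2) s p q]
    by (simp add: bary_def add_ac)
  ultimately show ?thesis
    by (simp add: cevian_perimeter_def Let_def feet flip: c_def r_def)
qed

section \<open>The symmedian point\<close>

text \<open>The tangent at \<open>A\<close> is the polar of \<open>A\<close>, so its equation is the vanishing of the form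
  at the given point and \<open>A\<close>.\<close>
lemma bary_in_tangent_line_iff:
  assumes "dist c A = r" "dist c B = r" "dist c C = r" "x + y + z = 1"
  shows "bary A B C x y z \<in> tangent_line c A \<longleftrightarrow> y * (dist A B)\<^sup>2 + z * (dist C A)\<^sup>2 = 0"
proof -
  have "(A - c) \<bullet> (A - c) = r\<^sup>2"
    using assms(1) by (auto simp: dist_norm norm_minus_commute simp flip: power2_norm_eq_inner)
  then have "polar_form c r Q A = - ((Q - A) \<bullet> (A - c))" for Q
    by (simp add: polar_form_def algebra_simps inner_diff_left)
  then have "bary A B C x y z \<in> tangent_line c A
      \<longleftrightarrow> polar_form c r (bary A B C x y z) A = 0"
    by (simp add: tangent_line_def)
  also have "A = bary A B C 1 0 0" by (simp add: bary_def)
  then have "polar_form c r (bary A B C x y z) A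
      = (y * (dist A B)\<^sup>2 + z * (dist C A)\<^sup>2) / 2"
    using polar_form_bary[OF assms, of 1 0 0] by simp
  finally show ?thesis by simp
qed

text \<open>With \<open>a = BC\<^sup>2\<close>, \<open>b = CA\<^sup>2\<close>, \<open>d = AB\<^sup>2\<close>, the tangents at \<open>B\<close> and \<open>C\<close> are the lines
  \<open>z a + x d = 0\<close> and \<open>x b + y a = 0\<close>, which both contain the coordinate triples
  proportional to \<open>(-a, b, d)\<close>. The sum of this triple is zero exactly if the angle at \<open>A\<close>
  is right. Then it is the common direction of the parallel tangents; otherwise it can be
  normalised to the point where they meet. In either case the line from \<open>A\<close> consists of the
  points with \<open>y : z = b : d\<close>.\<close>
lemma bary_in_symmedian_line_iff:
  fixes A B C :: "real^2"
  assumes nc: "\<not> collinear {A, B, C}"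
    and circ: "dist c A = r" "dist c B = r" "dist c C = r" and sum: "x + y + z = 1"
  shows "bary A B C x y z \<in> join_meet A (tangent_line c B) (tangent_line c C)
     \<longleftrightarrow> y * (dist A B)\<^sup>2 = z * (dist C A)\<^sup>2"
proof -
  define a b d where "a = (dist B C)\<^sup>2" and "b = (dist C A)\<^sup>2" and "d = (dist A B)\<^sup>2"
  have "A \<noteq> B" "B \<noteq> C" "C \<noteq> A" using nc by (auto simp: insert_commute)
  then have pos: "a > 0" "b > 0" "d > 0" by (auto simp: a_def b_def d_def)
  have tB: "bary A B C x y z \<in> tangent_line c B \<longleftrightarrow> z * a + x * d = 0"
    if "x + y + z = 1" for x y z
    using bary_in_tangent_line_iff[OF circ(2,3,1), of y z x] that
    by (simp add: bary_cycle a_def d_def add_ac)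
  have tC: "bary A B C x y z \<in> tangent_line c C \<longleftrightarrow> x * b + y * a = 0"
    if "x + y + z = 1" for x y z
    using bary_in_tangent_line_iff[OF circ(3,1,2), of z x y] that
    by (simp add: bary_cycle a_def b_def add_ac)
  have "bary A B C x y z \<in> join_meet A (tangent_line c B) (tangent_line c C) \<longleftrightarrow> y * d = z * b"
  proof (cases "b + d = a")
    case True
    have "P \<notin> tangent_line c B \<inter> tangent_line c C" for P
    proof
      assume P: "P \<in> tangent_line c B \<inter> tangent_line c C"
      obtain u v w where uvw: "u + v + w = 1" "P = bary A B C u v w"
        using bary_exists[OF nc] .
      have "w * a + u * d = 0" "u * b + v * a = 0"
        using P uvw tB tC by auto
      then have "a * (u + v + w) = 0" using True by algebra
      then show False using uvw pos by simp
    qed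
    then have J: "join_meet A (tangent_line c B) (tangent_line c C)
        = {A + (Q - R) | Q R. Q \<in> tangent_line c B \<and> R \<in> tangent_line c B}"
      by (auto simp: join_meet_def)
    show ?thesis
    proof
      assume "bary A B C x y z \<in> join_meet A (tangent_line c B) (tangent_line c C)"
      then obtain Q R where QR: "bary A B C x y z = A + (Q - R)"
        "Q \<in> tangent_line c B" "R \<in> tangent_line c B" unfolding J by blast
      obtain x1 y1 z1 where Q: "x1 + y1 + z1 = 1" "Q = bary A B C x1 y1 z1"
        using bary_exists[OF nc] .
      obtain x2 y2 z2 where R: "x2 + y2 + z2 = 1" "R = bary A B C x2 y2 z2"
        using bary_exists[OF nc] .
      have "A + (Q - R) = bary A B C (1 + x1 - x2) (y1 - y2) (z1 - z2)"
        unfolding Q R by (simp add: bary_def algebra_simps)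
      then have "bary A B C x y z = bary A B C (1 + x1 - x2) (y1 - y2) (z1 - z2)"
        using QR(1) by simp
      moreover have "x + y + z = (1 + x1 - x2) + (y1 - y2) + (z1 - z2)"
        using sum Q R by simp
      ultimately have coords: "x = 1 + x1 - x2" "y = y1 - y2" "z = z1 - z2"
        using bary_eq_iff[OF nc] by metis+
      have "z1 * a + x1 * d = 0" "z2 * a + x2 * d = 0" using QR Q R tB by auto
      then have "z * a + (x - 1) * d = 0" unfolding coords by algebra
      then show "y * d = z * b" using True sum by algebra
    next
      assume yz: "y * d = z * b"
      \<comment> \<open>The vector from \<open>A\<close> to the point, attached at \<open>B\<close>, ends on the tangent at \<open>B\<close>.\<close>
      have "bary A B C x y z = A + (bary A B C (x - 1) (1 + y) z - bary A B C 0 1 0)"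
        by (simp add: bary_def algebra_simps)
      moreover have "bary A B C 0 1 0 \<in> tangent_line c B" by (simp add: tB)
      moreover have "z * a + (x - 1) * d = 0" using yz True sum by algebra
      then have "bary A B C (x - 1) (1 + y) z \<in> tangent_line c B"
        using sum by (simp add: tB)
      ultimately show "bary A B C x y z \<in> join_meet A (tangent_line c B) (tangent_line c C)"
        unfolding J by blast
    qed
  next
    case False
    define k where "k = b + d - a"
    have k: "k \<noteq> 0" using False by (simp add: k_def)
    define T where "T = bary A B C (- a / k) (b / k) (d / k)"
    have sumT: "- a / k + b / k + d / k = 1"
    proof -
      have "- a / k + b / k + d / k = (- a + b + d) / k" by (simp only: add_divide_distrib)
      then show ?thesis using k by (simp add: k_def)
    qed
    have "P \<in> tangent_line c B \<inter> tangent_line c C \<longleftrightarrow> P = T" for P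
    proof
      assume P: "P \<in> tangent_line c B \<inter> tangent_line c C"
      obtain u v w where uvw: "u + v + w = 1" "P = bary A B C u v w"
        using bary_exists[OF nc] .
      have e: "w * a + u * d = 0" "u * b + v * a = 0"
        using P uvw tB tC by auto
      have "a * (u * k + a) = 0" "a * (v * k - b) = 0" "a * (w * k - d) = 0"
        using e uvw(1) unfolding k_def by algebra+
      then have "u * k = - a" "v * k = b" "w * k = d" using pos by auto
      then have "u = - a / k" "v = b / k" "w = d / k" using k by (auto simp: field_simps)
      then show "P = T" by (simp add: T_def uvw(2))
    next
      assume "P = T"
      then show "P \<in> tangent_line c B \<inter> tangent_line c C"
        by (simp only: T_def Int_iff tB[OF sumT] tC[OF sumT]) simp
    qed
    then have "tangent_line c B \<inter> tangent_line c C = {T}" by blast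
    then have J: "join_meet A (tangent_line c B) (tangent_line c C) = affine hull {A, T}"
      by (simp add: join_meet_def)
    have line: "u *\<^sub>R A + v *\<^sub>R T = bary A B C (u - v * a / k) (v * b / k) (v * d / k)" for u v
      by (simp add: T_def bary_def algebra_simps)
    show ?thesis
    proof
      assume "bary A B C x y z \<in> join_meet A (tangent_line c B) (tangent_line c C)"
      then obtain u v where uv: "u + v = 1" "bary A B C x y z = u *\<^sub>R A + v *\<^sub>R T"
        unfolding J affine_hull_2 by blast
      have "(u - v * a / k) + v * b / k + v * d / k = u + v * (- a / k + b / k + d / k)"
        by (simp add: algebra_simps)
      then have "x + y + z = (u - v * a / k) + v * b / k + v * d / k"
        using sumT sum uv(1) by simp
      then have "y = v * b / k" "z = v * d / k"
        using uv(2) unfolding line using bary_eq_iff[OF nc] by metis+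
      then show "y * d = z * b" by simp
    next
      assume yz: "y * d = z * b"
      define v where "v = y * k / b"
      have y: "v * b / k = y" using pos k by (simp add: v_def)
      have z: "v * d / k = z" using pos k yz by (simp add: v_def field_simps)
      have "v * (- a / k + b / k + d / k) = v" by (simp only: sumT mult_1_right)
      then have "1 - v - v * a / k = x"
        using y z sum by (simp add: algebra_simps)
      then have "bary A B C x y z = (1 - v) *\<^sub>R A + v *\<^sub>R T" unfolding line y z by simp
      then show "bary A B C x y z \<in> join_meet A (tangent_line c B) (tangent_line c C)"
        unfolding J affine_hull_2 by force
    qed
  qed
  then show ?thesis by (simp add: b_def d_def)
qed

lemma symmedian_point_bary:
  fixes A B C :: "real^2"
  assumes nc: "\<not> collinear {A, B, C}"
    and n: "n = (dist B C)\<^sup>2 + (dist C A)\<^sup>2 + (dist A B)\<^sup>2"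
  shows "symmedian_point A B C =
    bary A B C ((dist B C)\<^sup>2 / n) ((dist C A)\<^sup>2 / n) ((dist A B)\<^sup>2 / n)"
proof -
  define a b d where "a = (dist B C)\<^sup>2" and "b = (dist C A)\<^sup>2" and "d = (dist A B)\<^sup>2"
  have "A \<noteq> B" "B \<noteq> C" "C \<noteq> A" using nc by (auto simp: insert_commute)
  then have pos: "a > 0" "b > 0" "d > 0" by (auto simp: a_def b_def d_def)
  have "n = a + b + d" using n by (simp add: a_def b_def d_def)
  then have n: "n = a + b + d" "n \<noteq> 0" using pos by simp_all
  define c where "c = circumcenter A B C"
  define r where "r = dist c A"
  have circ: "dist c A = r" "dist c B = r" "dist c C = r"
    using circumcenter_equidistant[OF nc] by (simp_all add: c_def r_def)
  note nc2 = not_collinear_cycle[OF nc]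
  note nc3 = not_collinear_cycle[OF nc2]
  have iff: "bary A B C x y z \<in> join_meet A (tangent_line c B) (tangent_line c C) \<and>
      bary A B C x y z \<in> join_meet B (tangent_line c C) (tangent_line c A) \<and>
      bary A B C x y z \<in> join_meet C (tangent_line c A) (tangent_line c B)
      \<longleftrightarrow> y * d = z * b \<and> z * a = x * d \<and> x * b = y * a" if "x + y + z = 1" for x y z
    using bary_in_symmedian_line_iff[OF nc circ, of x y z]
      bary_in_symmedian_line_iff[OF nc2 circ(2,3,1), of y z x]
      bary_in_symmedian_line_iff[OF nc3 circ(3,1,2), of z x y] that
    by (simp add: bary_cycle a_def b_def d_def add_ac)
  have sum: "a / n + b / n + d / n = 1" using n by (simp flip: add_divide_distrib)
  have "symmedian_point A B C = bary A B C (a / n) (b / n) (d / n)"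
    unfolding symmedian_point_def Let_def c_def[symmetric]
  proof (rule the_equality)
    show "bary A B C (a / n) (b / n) (d / n) \<in> join_meet A (tangent_line c B) (tangent_line c C) \<and>
      bary A B C (a / n) (b / n) (d / n) \<in> join_meet B (tangent_line c C) (tangent_line c A) \<and>
      bary A B C (a / n) (b / n) (d / n) \<in> join_meet C (tangent_line c A) (tangent_line c B)"
      unfolding iff[OF sum] by simp
    fix S assume S: "S \<in> join_meet A (tangent_line c B) (tangent_line c C) \<and>
      S \<in> join_meet B (tangent_line c C) (tangent_line c A) \<and>
      S \<in> join_meet C (tangent_line c A) (tangent_line c B)"
    obtain x y z where xyz: "x + y + z = 1" "S = bary A B C x y z"
      using bary_exists[OF nc] .
    have "y * d = z * b" "z * a = x * d" "x * b = y * a"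
      using S iff[OF xyz(1)] unfolding xyz(2) by auto
    then have "x * n = a" "y * n = b" "z * n = d" using xyz(1) unfolding n(1) by algebra+
    then have "x = a / n" "y = b / n" "z = d / n" using n(2) by (auto simp: field_simps)
    then show "S = bary A B C (a / n) (b / n) (d / n)" by (simp add: xyz(2))
  qed
  then show ?thesis by (simp add: a_def b_def d_def)
qed

theorem theorem2p1:
  fixes A B C :: "real^2"
  assumes "\<not> collinear {A, B, C}"
  shows "symmedian_point A B C \<in> interior (convex hull {A, B, C}) \<and>
    (\<forall>X \<in> interior (convex hull {A, B, C}).
       cevian_perimeter A B C (symmedian_point A B C) \<le> cevian_perimeter A B C X)"
proof -
  define a b d where "a = (dist B C)\<^sup>2" and "b = (dist C A)\<^sup>2" and "d = (dist A B)\<^sup>2"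
  define n where "n = a + b + d"
  have "A \<noteq> B" "B \<noteq> C" "C \<noteq> A" using assms by (auto simp: insert_commute)
  then have pos: "a > 0" "b > 0" "d > 0" by (auto simp: a_def b_def d_def)
  then have n: "n > 0" by (simp add: n_def)
  have S: "symmedian_point A B C = bary A B C (a / n) (b / n) (d / n)"
    using symmedian_point_bary[OF assms] by (simp add: a_def b_def d_def n_def)
  have sum: "a / n + b / n + d / n = 1"
    using n by (simp flip: add_divide_distrib n_def add: add.assoc[symmetric])
  have int: "interior (convex hull {A, B, C})
      = {bary A B C x y z | x y z. 0 < x \<and> 0 < y \<and> 0 < z \<and> x + y + z = 1}"
    using interior_convex_hull_3_minimal[OF assms] by (auto simp: bary_def)
  \<comment> \<open>At the symmedian point the three numbers in the formula for the perimeter all equal \<open>p\<close>.\<close>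
  define p where "p = a * b * d / n\<^sup>2"
  have p: "p > 0" using pos n by (simp add: p_def)
  have "cevian_perimeter A B C (symmedian_point A B C)
      = 3 * arcosh ((p + p + p) / (2 * sqrt (p * p)))"
  proof -
    have "p = (b / n) * (d / n) * (dist B C)\<^sup>2" "p = (d / n) * (a / n) * (dist C A)\<^sup>2"
        "p = (a / n) * (b / n) * (dist A B)\<^sup>2"
      unfolding a_def[symmetric] b_def[symmetric] d_def[symmetric]
      by (simp_all add: p_def power2_eq_square)
    from cevian_perimeter_bary[OF assms _ _ _ sum this] show ?thesis
      using pos n by (simp add: S)
  qed
  also have "(p + p + p) / (2 * sqrt (p * p)) = 3 / 2" using p by simp
  finally have perS: "cevian_perimeter A B C (symmedian_point A B C) = 3 * arcosh (3 / 2)" .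
  have "3 * arcosh (3/2) \<le> cevian_perimeter A B C X"
    if X: "X \<in> interior (convex hull {A, B, C})" for X
  proof -
    obtain x y z where xyz: "X = bary A B C x y z" "x > 0" "y > 0" "z > 0" "x + y + z = 1"
      using X unfolding int by blast
    show ?thesis
      unfolding xyz(1) cevian_perimeter_bary[OF assms xyz(2-5) refl refl refl]
      by (rule arcosh_sum_ge) (use xyz pos in \<open>simp_all add: a_def b_def d_def\<close>)
  qed
  moreover have "symmedian_point A B C \<in> interior (convex hull {A, B, C})"
    unfolding int S using pos n sum by fastforce
  ultimately show ?thesis using perS by simp
qed

end
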